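(* Let $\mathcal{C}$ be a uniform clutter (all edges have the same cardinality) and assume $q\geq 3$. Let $L\subset\mathbb{Z}^n$ be the subgroup generated by $v_2-v_1,\ldots,v_s-v_1$ and let $\phi:\mathbb{Z}^n/L\to\mathbb{Z}^n/L$ be the multiplication map $\phi(\overline{a})=(q-1)\overline{a}$. Then $I(X)$ is a complete intersection (i.e. generated by $s-1$ homogeneous polynomials) if and only if $v_1,\ldots,v_s$ are linearly independent and $\phi$ is injective.
   Context: Let $K=\mathbb{F}_q$ be a finite field. A clutter $\mathcal{C}$ with vertex set $\{y_1,\ldots,y_n\}$ is a family of subsets (edges) of this set such that no edge is contained in another; let its edges be $f_1,\ldots,f_s$ ($s\geq 2$) with characteristic vectors $v_i=\sum_{y_j\in f_i}e_j\in\{0,1\}^n$. For $x\in K^n$ write $x^{v_i}=\prod_j x_j^{v_{ij}}$. Let $X=\{[(x^{v_1},\ldots,x^{v_s})]\in\mathbb{P}^{s-1}: x\in (K^* )^n\}$, let $S=K[t_1,\ldots,t_s]$ with the standard grading, and let $I(X)$ be the ideal of $S$ generated by the homogeneous polynomials vanishing on $X$. *)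

theory Defs
  imports Complex_Main "HOL-Library.Poly_Mapping" "HOL-Library.Cardinality"
begin

text \<open>Multivariate polynomials over a field 'a: finitely supported maps from
monomials (exponent vectors) to coefficients. The ring
S = K[t_0,...,t_{s-1}] is the set of those polynomials only involving
variables with index < s (variables indexed from 0).\<close>

type_synonym 'a mpoly = "(nat \<Rightarrow>\<^sub>0 nat) \<Rightarrow>\<^sub>0 'a"

definition in_S :: "nat \<Rightarrow> ('a::zero) mpoly \<Rightarrow> bool" where
  "in_S s p \<longleftrightarrow> (\<forall>m::nat \<Rightarrow>\<^sub>0 nat. m \<in> Poly_Mapping.keys p \<longrightarrow> Poly_Mapping.keys m \<subseteq> {..<s})"

definition mon_deg :: "(nat \<Rightarrow>\<^sub>0 nat) \<Rightarrow> nat" where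
  "mon_deg m = (\<Sum>i\<in>Poly_Mapping.keys m. Poly_Mapping.lookup m i)"

definition homogeneous :: "('a::zero) mpoly \<Rightarrow> bool" where
  "homogeneous p \<longleftrightarrow> (\<exists>d. \<forall>m\<in>Poly_Mapping.keys p. mon_deg m = d)"

definition mpeval :: "('a::comm_semiring_1) mpoly \<Rightarrow> (nat \<Rightarrow> 'a) \<Rightarrow> 'a" where
  "mpeval p t = (\<Sum>m\<in>Poly_Mapping.keys p. Poly_Mapping.lookup p m * (\<Prod>i\<in>Poly_Mapping.keys m. t i ^ Poly_Mapping.lookup m i))"

definition gen_ideal :: "nat \<Rightarrow> ('a::comm_ring_1) mpoly set \<Rightarrow> 'a mpoly set" where
  "gen_ideal s G = {(\<Sum>g\<in>F. r g * g) | F r. finite F \<and> F \<subseteq> G \<and> (\<forall>g\<in>F. in_S s (r g))}"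

definition clutter :: "nat \<Rightarrow> nat \<Rightarrow> (nat \<Rightarrow> nat set) \<Rightarrow> bool" where
  "clutter n s f \<longleftrightarrow> (\<forall>i<s. f i \<subseteq> {..<n}) \<and> (\<forall>i<s. \<forall>j<s. i \<noteq> j \<longrightarrow> \<not> f i \<subseteq> f j)"

definition uniform_clutter :: "nat \<Rightarrow> nat \<Rightarrow> (nat \<Rightarrow> nat set) \<Rightarrow> bool" where
  "uniform_clutter n s f \<longleftrightarrow> clutter n s f \<and> (\<forall>i<s. \<forall>j<s. card (f i) = card (f j))"

text \<open>Characteristic vector v_i \<in> Z^n of edge f i (as a function nat \<Rightarrow> int, zero outside {..<n}).\<close>
definition charvec :: "(nat \<Rightarrow> nat set) \<Rightarrow> nat \<Rightarrow> nat \<Rightarrow> int" where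
  "charvec f i = (\<lambda>j. if j \<in> f i then 1 else 0)"

text \<open>Affine representatives (x^{v_1},...,x^{v_s}) of the points of X, x \<in> (K^*)^n.\<close>
definition param_points :: "nat \<Rightarrow> (nat \<Rightarrow> nat set) \<Rightarrow> (nat \<Rightarrow> 'a::field) set" where
  "param_points n f = {(\<lambda>i. \<Prod>j\<in>f i. x j) | x. \<forall>j<n. x j \<noteq> 0}"

definition vanishing_ideal :: "nat \<Rightarrow> nat \<Rightarrow> (nat \<Rightarrow> nat set) \<Rightarrow> ('a::field) mpoly set" where
  "vanishing_ideal n s f = gen_ideal s
     {p. in_S s p \<and> homogeneous p \<and> (\<forall>P\<in>param_points n f. mpeval p P = 0)}"

definition complete_intersection :: "nat \<Rightarrow> ('a::field) mpoly set \<Rightarrow> bool" where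
  "complete_intersection s I \<longleftrightarrow>
     (\<exists>g :: nat \<Rightarrow> 'a mpoly. (\<forall>i<s-1. in_S s (g i) \<and> homogeneous (g i)) \<and>
         I = gen_ideal s (g ` {..<s-1}))"

definition charvecs_lin_indep :: "nat \<Rightarrow> nat \<Rightarrow> (nat \<Rightarrow> nat set) \<Rightarrow> bool" where
  "charvecs_lin_indep n s f \<longleftrightarrow>
     (\<forall>c :: nat \<Rightarrow> rat. (\<forall>j<n. (\<Sum>i<s. c i * of_int (charvec f i j)) = 0) \<longrightarrow> (\<forall>i<s. c i = 0))"

definition lattice_L :: "nat \<Rightarrow> (nat \<Rightarrow> nat set) \<Rightarrow> (nat \<Rightarrow> int) set" where
  "lattice_L s f = {(\<lambda>j. \<Sum>i\<in>{1..<s}. c i * (charvec f i j - charvec f 0 j)) | c :: nat \<Rightarrow> int. True}"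

text \<open>Injectivity of \<phi>: Z^n/L \<rightarrow> Z^n/L, \<phi>(a + L) = (q-1)a + L.\<close>
definition phi_injective :: "nat \<Rightarrow> nat \<Rightarrow> (nat \<Rightarrow> nat set) \<Rightarrow> nat \<Rightarrow> bool" where
  "phi_injective n s f q \<longleftrightarrow>
     (\<forall>a :: nat \<Rightarrow> int. (\<forall>j. j \<ge> n \<longrightarrow> a j = 0) \<longrightarrow>
        (\<lambda>j. (int q - 1) * a j) \<in> lattice_L s f \<longrightarrow> a \<in> lattice_L s f)"

end

theory Submission
  imports Defs "HOL-Computational_Algebra.Polynomial" "HOL-Library.FuncSet"
begin

text \<open>
  Both sides are equivalent to \<open>X\<close> being the full projective torus, whose ideal is generated by
  the \<open>t\<^sub>i\<^bsup>q-1\<^esup> - t\<^sub>0\<^bsup>q-1\<^esup>\<close>; arithmetically, an integral combination of the \<open>v\<^sub>i - v\<^sub>0\<close> is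
  divisible by \<open>q - 1\<close> only if all its coefficients are.

  If the ideal of \<open>X\<close> is a complete intersection, note that its homogeneous elements of degree
  less than \<open>q - 1\<close> contain no pure powers \<open>t\<^sub>k\<^bsup>e\<^esup>\<close>, because no edge contains another. Comparing
  coefficients of pure powers, the \<open>s - 1\<close> elements \<open>t\<^sub>i\<^bsup>q-1\<^esup> - t\<^sub>0\<^bsup>q-1\<^esup>\<close> can only arise if all
  \<open>s - 1\<close> generators have degree \<open>q - 1\<close> and span the same space, so the ideal vanishes on the
  torus. Conversely, modulo \<open>t\<^sub>i\<^bsup>q-1\<^esup> - t\<^sub>0\<^bsup>q-1\<^esup>\<close> a homogeneous polynomial reduces to one whose
  monomials give pairwise distinct characters of \<open>(K\<^sup>*)\<^sup>n\<close>, and these are linearly independent.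
\<close>

abbreviation "lookup \<equiv> Poly_Mapping.lookup"
abbreviation "keys \<equiv> Poly_Mapping.keys"
abbreviation "single \<equiv> Poly_Mapping.single"

section \<open>Polynomials\<close>

lemma poly_mapping_sum_single: "(\<Sum>m\<in>keys p. single m (lookup p m)) = p"
  by (rule poly_mapping_eqI) (auto simp: lookup_sum lookup_single when_def in_keys_iff)

text \<open>The step allows \<open>m\<close> to be a key of \<open>p\<close> already, so identities
  linear in \<open>p\<close> reduce to the case of one term without case distinctions.\<close>

lemma poly_mapping_induct [case_names zero add_single]:
  fixes p :: "'b \<Rightarrow>\<^sub>0 'a::comm_monoid_add"
  assumes "P 0" and "\<And>p m c. P p \<Longrightarrow> P (single m c + p)"
  shows "P p"
proof -
  have "P (\<Sum>m\<in>A. single m (lookup p m))" if "finite A" for A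
    using that by (induction A rule: finite_induct) (auto intro: assms)
  then show ?thesis
    using poly_mapping_sum_single [of p] by (metis finite_keys)
qed

section \<open>Evaluation and degree of monomials\<close>

definition mon_eval :: "(nat \<Rightarrow>\<^sub>0 nat) \<Rightarrow> (nat \<Rightarrow> 'a::comm_semiring_1) \<Rightarrow> 'a" where
  "mon_eval m t = (\<Prod>i\<in>keys m. t i ^ lookup m i)"

lemma mon_eval_superset:
  assumes "finite A" "keys m \<subseteq> A"
  shows "mon_eval m t = (\<Prod>i\<in>A. t i ^ lookup m i)"
  unfolding mon_eval_def by (rule prod.mono_neutral_left) (use assms in \<open>auto simp: in_keys_iff\<close>)

lemma mon_eval_0 [simp]: "mon_eval 0 t = 1"
  by (simp add: mon_eval_def)

lemma mon_eval_single [simp]: "mon_eval (single i e) t = t i ^ e"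
  by (simp add: mon_eval_def)

lemma mon_eval_add: "mon_eval (m + m') t = mon_eval m t * mon_eval m' t"
proof -
  let ?A = "keys m \<union> keys m'"
  have "mon_eval (m + m') t = (\<Prod>i\<in>?A. t i ^ lookup (m + m') i)"
    by (rule mon_eval_superset) (use keys_add[of m m'] in auto)
  also have "\<dots> = (\<Prod>i\<in>?A. t i ^ lookup m i) * (\<Prod>i\<in>?A. t i ^ lookup m' i)"
    by (simp add: lookup_add power_add prod.distrib)
  also have "\<dots> = mon_eval m t * mon_eval m' t"
    by (simp add: mon_eval_superset[of ?A])
  finally show ?thesis .
qed

lemma mon_deg_superset:
  assumes "finite A" "keys m \<subseteq> A"
  shows "mon_deg m = (\<Sum>i\<in>A. lookup m i)"
  unfolding mon_deg_def by (rule sum.mono_neutral_left) (use assms in \<open>auto simp: in_keys_iff\<close>)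

lemma mon_deg_single [simp]: "mon_deg (single i e) = e"
  by (simp add: mon_deg_def)

lemma mon_deg_add [simp]: "mon_deg (m + m') = mon_deg m + mon_deg m'"
proof -
  let ?A = "keys m \<union> keys m'"
  have "mon_deg (m + m') = (\<Sum>i\<in>?A. lookup (m + m') i)"
    by (rule mon_deg_superset) (use keys_add[of m m'] in auto)
  also have "\<dots> = mon_deg m + mon_deg m'"
    by (simp add: lookup_add sum.distrib mon_deg_superset[of ?A])
  finally show ?thesis .
qed

lemma mon_deg_eq_0_iff [simp]: "mon_deg m = 0 \<longleftrightarrow> m = 0"
  by (auto simp: mon_deg_def in_keys_iff intro: poly_mapping_eqI)

lemma mpeval_alt: "mpeval p t = (\<Sum>m\<in>keys p. lookup p m * mon_eval m t)"
  by (simp add: mpeval_def mon_eval_def)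

lemma mpeval_0 [simp]: "mpeval 0 t = 0"
  by (simp add: mpeval_def)

lemma mpeval_single [simp]: "mpeval (single m c) t = c * mon_eval m t"
  by (simp add: mpeval_alt)

lemma mpeval_add: "mpeval (p + q) t = mpeval p t + mpeval q t"
  unfolding mpeval_alt
  by (rule setsum_keys_plus_distrib) (simp_all add: algebra_simps)

lemma mpeval_diff: "mpeval (p - q) t = mpeval p t - mpeval q (t :: nat \<Rightarrow> 'a::comm_ring_1)"
  using mpeval_add[of "p - q" q t] by simp

lemma mpeval_sum: "mpeval (\<Sum>i\<in>A. p i) t = (\<Sum>i\<in>A. mpeval (p i) t)"
  by (induction A rule: infinite_finite_induct) (auto simp: mpeval_add)

lemma mpeval_mult: "mpeval (p * q) t = mpeval p t * mpeval q t"
proof (induction p rule: poly_mapping_induct)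
  case (add_single p m c)
  have "mpeval (single m c * q) t = mpeval (single m c) t * mpeval q t"
    by (induction q rule: poly_mapping_induct)
       (simp_all add: mult_single mon_eval_add mpeval_add algebra_simps)
  with add_single show ?case
    by (simp add: distrib_right mpeval_add)
qed simp

lemma lookup_const_mult: "lookup (single 0 c * p) m = c * lookup p m"
  for p :: "'b::comm_monoid_add \<Rightarrow>\<^sub>0 'a::comm_semiring_1"
  by (induction p rule: poly_mapping_induct)
     (simp_all add: mult_single lookup_add lookup_single when_def algebra_simps)

text \<open>Split the constant term off \<open>r\<close>: every monomial of the remaining product
  has the form \<open>a + b\<close> with \<open>a\<close> nonzero, and by assumption none of these
  is \<open>m\<close>. This isolates the constant terms of the coefficients in an ideal
  representation.\<close>

lemma lookup_mult_only_const:
  fixes r p :: "'a::comm_ring_1 mpoly"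
  assumes "\<And>a b. a \<noteq> 0 \<Longrightarrow> b \<in> keys p \<Longrightarrow> a + b \<noteq> m"
  shows "lookup (r * p) m = lookup r 0 * lookup p m"
proof -
  define r' where "r' = r - single 0 (lookup r 0)"
  have "0 \<notin> keys r'"
    by (simp add: r'_def in_keys_iff lookup_minus)
  have "m \<notin> keys (r' * p)"
  proof
    assume "m \<in> keys (r' * p)"
    then obtain a b where "m = a + b" "a \<in> keys r'" "b \<in> keys p"
      using keys_mult[of r' p] by blast
    with assms[of a b] \<open>0 \<notin> keys r'\<close> show False by auto
  qed
  then have "lookup (r' * p) m = 0"
    by (simp add: in_keys_iff)
  moreover have "r * p = r' * p + single 0 (lookup r 0) * p"
    by (simp add: r'_def algebra_simps)
  ultimately show ?thesis
    by (simp add: lookup_add lookup_const_mult)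
qed

lemma in_S_0 [simp]: "in_S s 0"
  by (simp add: in_S_def)

lemma in_S_single: "keys m \<subseteq> {..<s} \<Longrightarrow> in_S s (single m c)"
  by (simp add: in_S_def)

lemma in_S_1 [simp]: "in_S s (1 :: 'a::comm_semiring_1 mpoly)"
  by (simp add: in_S_def)

lemma in_S_add: "in_S s p \<Longrightarrow> in_S s q \<Longrightarrow> in_S s (p + q)"
  using keys_add[of p q] by (fastforce simp: in_S_def)

lemma in_S_diff: "in_S s p \<Longrightarrow> in_S s q \<Longrightarrow> in_S s (p - q)"
  for p :: "'a::comm_ring_1 mpoly"
  using keys_diff[of p q] by (fastforce simp: in_S_def)

lemma in_S_sum: "(\<And>i. i \<in> A \<Longrightarrow> in_S s (p i)) \<Longrightarrow> in_S s (\<Sum>i\<in>A. p i)"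
  by (induction A rule: infinite_finite_induct) (auto intro: in_S_add)

lemma in_S_mult:
  fixes p q :: "'a::comm_semiring_1 mpoly"
  assumes "in_S s p" "in_S s q"
  shows "in_S s (p * q)"
  unfolding in_S_def
proof (intro allI impI)
  fix m assume "m \<in> keys (p * q)"
  then obtain a b where ab: "m = a + b" "a \<in> keys p" "b \<in> keys q"
    using keys_mult[of p q] by blast
  then have "keys m \<subseteq> keys a \<union> keys b"
    by (simp add: keys_add)
  with ab assms show "keys m \<subseteq> {..<s}"
    by (fastforce simp: in_S_def)
qed

section \<open>Ideals\<close>

lemma gen_ideal_0 [simp]: "0 \<in> gen_ideal s G"
  unfolding gen_ideal_def by (rule CollectI, rule exI[of _ "{}"]) simp

lemma gen_ideal_base: "g \<in> G \<Longrightarrow> g \<in> gen_ideal s G"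
  unfolding gen_ideal_def by (rule CollectI, rule exI[of _ "{g}"], rule exI[of _ "\<lambda>_. 1"]) simp

lemma gen_ideal_mult:
  assumes "p \<in> gen_ideal s G" "in_S s a"
  shows "a * p \<in> gen_ideal s G"
proof -
  from assms obtain F r where "finite F" "F \<subseteq> G" "\<forall>g\<in>F. in_S s (r g)" "p = (\<Sum>g\<in>F. r g * g)"
    by (auto simp: gen_ideal_def)
  then show ?thesis
    unfolding gen_ideal_def
    by (intro CollectI exI[of _ F] exI[of _ "\<lambda>g. a * r g"])
       (use assms in \<open>auto simp: sum_distrib_left mult.assoc intro: in_S_mult\<close>)
qed

text \<open>The two representations use different finite sets of generators, so both are extended by
  zero to the union.\<close>

lemma gen_ideal_add:
  assumes "p \<in> gen_ideal s G" "q \<in> gen_ideal s G"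
  shows "p + q \<in> gen_ideal s G"
proof -
  from assms(1) obtain F r where
    F: "finite F" "F \<subseteq> G" "\<forall>g\<in>F. in_S s (r g)" "p = (\<Sum>g\<in>F. r g * g)"
    by (auto simp: gen_ideal_def)
  from assms(2) obtain F' r' where
    F': "finite F'" "F' \<subseteq> G" "\<forall>g\<in>F'. in_S s (r' g)" "q = (\<Sum>g\<in>F'. r' g * g)"
    by (auto simp: gen_ideal_def)
  define R where "R = (\<lambda>g. (if g \<in> F then r g else 0) + (if g \<in> F' then r' g else 0))"
  have "p = (\<Sum>g\<in>F \<union> F'. (if g \<in> F then r g else 0) * g)"
    unfolding F(4) by (rule sum.mono_neutral_cong_left) (use F F' in auto)
  moreover have "q = (\<Sum>g\<in>F \<union> F'. (if g \<in> F' then r' g else 0) * g)"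
    unfolding F'(4) by (rule sum.mono_neutral_cong_left) (use F F' in auto)
  ultimately have "p + q = (\<Sum>g\<in>F \<union> F'. R g * g)"
    unfolding R_def by (simp only: distrib_right sum.distrib)
  then show ?thesis
    unfolding gen_ideal_def
    by (intro CollectI exI[of _ "F \<union> F'"] exI[of _ R])
       (use F F' in \<open>auto simp: R_def intro!: in_S_add\<close>)
qed

lemma gen_ideal_sum: "(\<And>i. i \<in> A \<Longrightarrow> p i \<in> gen_ideal s G) \<Longrightarrow> (\<Sum>i\<in>A. p i) \<in> gen_ideal s G"
  by (induction A rule: infinite_finite_induct) (auto intro: gen_ideal_add)

lemma gen_ideal_subset:
  assumes "G \<subseteq> gen_ideal s H"
  shows "gen_ideal s G \<subseteq> gen_ideal s H"
proof
  fix p assume "p \<in> gen_ideal s G"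
  then obtain F r where "finite F" "F \<subseteq> G" "\<forall>g\<in>F. in_S s (r g)" "p = (\<Sum>g\<in>F. r g * g)"
    by (auto simp: gen_ideal_def)
  with assms show "p \<in> gen_ideal s H"
    by (auto intro!: gen_ideal_sum gen_ideal_mult)
qed

text \<open>Passes from sums over a set of generators to sums over an indexed family. As
  \<open>g\<close> may repeat values, each generator used gets one representative index, and all
  other indices get coefficient zero.\<close>

lemma gen_ideal_image:
  fixes g :: "'b \<Rightarrow> 'a::comm_ring_1 mpoly"
  assumes "p \<in> gen_ideal s (g ` A)" "finite A"
  obtains r where "p = (\<Sum>j\<in>A. r j * g j)"
proof -
  from assms obtain F r where F: "finite F" "F \<subseteq> g ` A" "p = (\<Sum>h\<in>F. r h * h)"
    by (auto simp: gen_ideal_def)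
  obtain B where B: "B \<subseteq> A" "inj_on g B" "F = g ` B"
    using F(2) by (meson subset_image_inj)
  have "p = (\<Sum>j\<in>B. r (g j) * g j)"
    using F(3) B by (simp add: sum.reindex)
  also have "\<dots> = (\<Sum>j\<in>A. (if j \<in> B then r (g j) else 0) * g j)"
    by (rule sum.mono_neutral_cong_left) (use assms B in auto)
  finally show ?thesis by (rule that)
qed

lemma gen_ideal_mpeval_eq_0:
  assumes "p \<in> gen_ideal s G" "\<And>g. g \<in> G \<Longrightarrow> mpeval g t = 0"
  shows "mpeval p t = 0"
  using assms by (auto simp: gen_ideal_def mpeval_sum mpeval_mult subset_iff)

section \<open>Finite fields\<close>

text \<open>Multiplication by \<open>x\<close> permutes the units, so the product of all units can
  be cancelled.\<close>

lemma finite_field_power_card_minus_1: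
  fixes x :: "'a::{finite,field}"
  assumes "x \<noteq> 0"
  shows "x ^ (CARD('a) - 1) = 1"
proof -
  let ?U = "UNIV - {0::'a}"
  have "bij_betw ((*) x) ?U ?U"
    by (rule bij_betw_byWitness[where f' = "\<lambda>y. y / x"]) (use assms in auto)
  then have "(\<Prod>y\<in>?U. y) = (\<Prod>y\<in>?U. x * y)"
    by (rule prod.reindex_bij_betw[symmetric])
  also have "\<dots> = x ^ card ?U * (\<Prod>y\<in>?U. y)"
    by (simp add: prod.distrib)
  finally have "x ^ card ?U = 1"
    by simp
  then show ?thesis
    by (simp add: card_Diff_subset)
qed

lemma finite_field_power_mod:
  fixes x :: "'a::{finite,field}"
  assumes "x \<noteq> 0"
  shows "x ^ (a mod (CARD('a) - 1)) = x ^ a"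
proof -
  let ?k = "CARD('a) - 1"
  have "x ^ a = x ^ (?k * (a div ?k) + a mod ?k)"
    by simp
  also have "\<dots> = x ^ (a mod ?k)"
    by (simp only: power_add power_mult finite_field_power_card_minus_1[OF assms]) simp
  finally show ?thesis ..
qed

lemma poly_eq_0_if_vanishes_on_units:
  fixes P :: "'a::{finite,field} poly"
  assumes "\<And>x. x \<noteq> 0 \<Longrightarrow> poly P x = 0" and "degree P < CARD('a) - 1"
  shows "P = 0"
proof (rule ccontr)
  assume "P \<noteq> 0"
  then have "card {x. poly P x = 0} \<le> degree P"
    by (rule card_poly_roots_bound)
  moreover have "card (UNIV - {0::'a}) \<le> card {x. poly P x = 0}"
    by (rule card_mono) (use assms in auto)
  ultimately show False
    using assms(2) by (simp add: card_Diff_subset)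
qed

text \<open>The sum is a polynomial in \<open>x\<close> with too small a degree to have all units as
  roots, so it is the zero polynomial. Different \<open>m\<close> may share an exponent.\<close>

lemma power_sum_vanishes_at_0:
  fixes a :: "'b \<Rightarrow> 'a::{finite,field}"
  assumes "finite M" and "\<And>m. m \<in> M \<Longrightarrow> e m < CARD('a) - 1"
    and "\<And>x. x \<noteq> 0 \<Longrightarrow> (\<Sum>m\<in>M. a m * x ^ e m) = 0"
  shows "(\<Sum>m\<in>M. a m * 0 ^ e m) = 0"
proof (cases "M = {}")
  case False
  define P where "P = (\<Sum>m\<in>M. monom (a m) (e m))"
  have ev: "poly P x = (\<Sum>m\<in>M. a m * x ^ e m)" for x
    by (simp add: P_def poly_sum poly_monom)
  have "degree P \<le> CARD('a) - 2"
    unfolding P_def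
    by (rule degree_sum_le) (use assms in \<open>fastforce intro: order.trans[OF degree_monom_le]\<close>)+
  \<comment> \<open>A nonempty \<open>M\<close> supplies an exponent below \<open>q - 1\<close>,
    which rules out truncated subtraction.\<close>
  moreover have "CARD('a) - 2 < CARD('a) - 1"
    using False assms(2) by fastforce
  ultimately have "P = 0"
    by (intro poly_eq_0_if_vanishes_on_units) (auto simp: ev assms)
  with ev[of 0] show ?thesis by simp
qed simp

text \<open>With both exponents reduced modulo \<open>q - 1\<close>, the difference of the two
  monomials has degree below the number of its roots.\<close>

lemma units_power_eq_imp_cong:
  assumes "\<And>x :: 'a::{finite,field}. x \<noteq> 0 \<Longrightarrow> x ^ a = x ^ b" and "CARD('a) \<ge> 3"
  shows "a mod (CARD('a) - 1) = b mod (CARD('a) - 1)"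
proof -
  let ?k = "CARD('a) - 1"
  define P :: "'a poly" where "P = monom 1 (a mod ?k) - monom 1 (b mod ?k)"
  have "degree P \<le> max (a mod ?k) (b mod ?k)"
    unfolding P_def by (rule degree_diff_le_max[THEN order.trans]) (simp add: degree_monom_eq)
  also have "\<dots> < ?k"
    using assms(2) by simp
  finally have "P = 0"
    by (intro poly_eq_0_if_vanishes_on_units)
       (simp_all only: P_def poly_monom poly_diff finite_field_power_mod assms(1) not_False_eq_True diff_self)
  then show ?thesis
    by (simp add: P_def monom_eq_iff')
qed

section \<open>Linear algebra\<close>

text \<open>Over a finite ring a right inverse of a square matrix is also a left inverse,
  since surjective self-maps of a finite set are injective.\<close>

lemma right_inverse_imp_left_inverse:
  fixes R G :: "nat \<Rightarrow> nat \<Rightarrow> 'a::{finite,comm_ring_1}"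
  assumes inv: "\<And>i k. i < N \<Longrightarrow> k < N \<Longrightarrow> (\<Sum>j<N. R i j * G j k) = (if i = k then 1 else 0)"
    and "j < N" "k < N"
  shows "(\<Sum>i<N. G j i * R i k) = (if j = k then 1 else 0)"
proof -
  \<comment> \<open>Vectors are extensional functions, so that \<open>E\<close> is finite and
    equality on \<open>{..<N}\<close> is equality.\<close>
  define E where "E = {..<N} \<rightarrow>\<^sub>E (UNIV :: 'a set)"
  define app where "app = (\<lambda>A u. restrict (\<lambda>i. \<Sum>j<N. A i j * u j) {..<N} :: nat \<Rightarrow> 'a)"
  have app: "app A u i = (\<Sum>j<N. A i j * u j)" if "i < N" for A u i
    using that by (simp add: app_def)
  have app_beyond: "app A u i = undefined" if "\<not> i < N" for A u i
    using that by (simp add: app_def)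
  have app_in: "app A u \<in> E" for A u
    by (auto simp: app_def E_def)
  have RG: "app R (app G u) = u" if "u \<in> E" for u
  proof
    fix i
    show "app R (app G u) i = u i"
    proof (cases "i < N")
      case True
      have "app R (app G u) i = (\<Sum>j<N. \<Sum>k<N. R i j * G j k * u k)"
        using True by (simp add: app sum_distrib_left mult.assoc)
      also have "\<dots> = (\<Sum>k<N. \<Sum>j<N. R i j * G j k * u k)"
        by (rule sum.swap)
      also have "\<dots> = (\<Sum>k<N. (if i = k then 1 else 0) * u k)"
        using True by (intro sum.cong refl) (simp add: inv flip: sum_distrib_right)
      also have "\<dots> = (\<Sum>k<N. if i = k then u k else 0)"
        by (intro sum.cong) auto
      also have "\<dots> = u i"
        using True by simp
      finally show ?thesis .
    next
      case False
      then have "u i = undefined"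
        by (intro PiE_arb[OF that[unfolded E_def]]) simp
      with False show ?thesis
        by (simp add: app_beyond)
    qed
  qed
  have "finite E"
    by (simp add: E_def finite_PiE)
  moreover have "E \<subseteq> app R ` E"
  proof
    fix u assume "u \<in> E"
    from RG[OF this, symmetric] app_in show "u \<in> app R ` E" by (rule image_eqI)
  qed
  ultimately have "inj_on (app R) E"
    by (rule finite_surj_inj)
  then have GR: "app G (app R u) = u" if "u \<in> E" for u
    by (rule inj_onD) (use RG app_in that in auto)
  \<comment> \<open>The \<open>k\<close>-th standard basis vector, which extracts the
    \<open>k\<close>-th column of the product.\<close>
  define u where "u = restrict (\<lambda>j. if j = k then 1 else 0 :: 'a) {..<N}"
  have "app R u i = R i k" if "i < N" for i
  proof -
    have "app R u i = (\<Sum>j<N. if j = k then R i j else 0)"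
      unfolding app[OF that] by (intro sum.cong) (auto simp: u_def)
    also have "\<dots> = R i k"
      using assms by simp
    finally show ?thesis .
  qed
  then have "app G (app R u) j = (\<Sum>i<N. G j i * R i k)"
    using assms by (simp add: app[of j])
  moreover have "u \<in> E"
    by (auto simp: u_def E_def)
  ultimately show ?thesis
    using GR[of u] assms by (simp add: u_def)
qed

text \<open>Dedekind's argument: scale the relation by the value of one character and subtract.\<close>

lemma characters_lin_indep:
  fixes \<chi> :: "'b \<Rightarrow> 'g \<Rightarrow> 'a::field"
  assumes "finite M"
    and closed: "\<And>x y. x \<in> G \<Longrightarrow> y \<in> G \<Longrightarrow> mul x y \<in> G"
    and hom: "\<And>m x y. m \<in> M \<Longrightarrow> x \<in> G \<Longrightarrow> y \<in> G \<Longrightarrow> \<chi> m (mul x y) = \<chi> m x * \<chi> m y"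
    and nz: "\<And>m. m \<in> M \<Longrightarrow> \<exists>x\<in>G. \<chi> m x \<noteq> 0"
    and dist: "\<And>m m'. m \<in> M \<Longrightarrow> m' \<in> M \<Longrightarrow> m \<noteq> m' \<Longrightarrow> \<exists>x\<in>G. \<chi> m x \<noteq> \<chi> m' x"
    and rel: "\<And>x. x \<in> G \<Longrightarrow> (\<Sum>m\<in>M. a m * \<chi> m x) = 0"
  shows "\<forall>m\<in>M. a m = 0"
  using \<open>finite M\<close> hom nz dist rel
proof (induction M arbitrary: a rule: finite_induct)
  case (insert m\<^sub>0 M)
  have a0: "a m = 0" if m: "m \<in> M" for m
  proof -
    have ay: "\<forall>m\<in>M. a m * (\<chi> m y - \<chi> m\<^sub>0 y) = 0" if y: "y \<in> G" for y
    proof (rule insert.IH)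
      fix x assume x: "x \<in> G"
      have "(\<Sum>m\<in>M. a m * (\<chi> m y - \<chi> m\<^sub>0 y) * \<chi> m x)
          = (\<Sum>m\<in>M. a m * \<chi> m (mul x y)) - \<chi> m\<^sub>0 y * (\<Sum>m\<in>M. a m * \<chi> m x)"
        using x y insert.prems(1)
        by (simp add: sum_distrib_left algebra_simps flip: sum_subtractf)
      also have "(\<Sum>m\<in>M. a m * \<chi> m (mul x y)) = - a m\<^sub>0 * \<chi> m\<^sub>0 x * \<chi> m\<^sub>0 y"
        using insert.prems(4)[OF closed[OF x y]] insert.hyps insert.prems(1) x y
        by (simp add: eq_neg_iff_add_eq_0 add.commute mult.assoc)
      also have "(\<Sum>m\<in>M. a m * \<chi> m x) = - a m\<^sub>0 * \<chi> m\<^sub>0 x"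
        using insert.prems(4)[OF x] insert.hyps
        by (simp add: eq_neg_iff_add_eq_0 add.commute)
      finally show "(\<Sum>m\<in>M. a m * (\<chi> m y - \<chi> m\<^sub>0 y) * \<chi> m x) = 0"
        by simp
    qed (use insert.prems in auto)
    from m insert.hyps obtain y where "y \<in> G" "\<chi> m y \<noteq> \<chi> m\<^sub>0 y"
      using insert.prems(3)[of m m\<^sub>0] by auto
    with ay m show ?thesis by fastforce
  qed
  from insert.prems(2) obtain x where "x \<in> G" "\<chi> m\<^sub>0 x \<noteq> 0" by blast
  moreover from this have "a m\<^sub>0 * \<chi> m\<^sub>0 x = 0"
    using insert.prems(4)[of x] insert.hyps a0 by simp
  ultimately show ?case
    using a0 by auto
qed simp

section \<open>The arithmetic condition\<close>

text \<open>For \<open>k = q - 1\<close> this says that only the trivial character of the projective torus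
  \<open>(K\<^sup>*)\<^sup>s / K\<^sup>*\<close> is trivial on the set \<open>X\<close>, i.e. that \<open>X\<close> is the whole torus.\<close>

definition indep_mod :: "nat \<Rightarrow> (nat \<Rightarrow> nat set) \<Rightarrow> nat \<Rightarrow> bool" where
  "indep_mod s f k \<longleftrightarrow>
     (\<forall>c :: nat \<Rightarrow> int. (\<forall>j. int k dvd (\<Sum>i\<in>{1..<s}. c i * (charvec f i j - charvec f 0 j))) \<longrightarrow>
        (\<forall>i\<in>{1..<s}. int k dvd c i))"

lemma lessThan_eq_insert_0: "s \<ge> 1 \<Longrightarrow> {..<s} = insert 0 {1..<s}" for s :: nat
  by auto

text \<open>Since \<open>c 0\<close> is minus the sum of the other coefficients, relations among the
  differences \<open>v i - v 0\<close> correspond to relations among the \<open>v i\<close> with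
  coefficient sum zero.\<close>

lemma sum_mult_diff_eq:
  fixes c v :: "nat \<Rightarrow> 'b::comm_ring"
  assumes "(\<Sum>i<s. c i) = 0" "s \<ge> 1"
  shows "(\<Sum>i\<in>{1..<s}. c i * (v i - v 0)) = (\<Sum>i<s. c i * v i)"
proof -
  have "c 0 = - (\<Sum>i\<in>{1..<s}. c i)"
    using assms by (simp add: lessThan_eq_insert_0 eq_neg_iff_add_eq_0)
  then show ?thesis
    using assms(2)
    by (simp add: lessThan_eq_insert_0 algebra_simps sum_subtractf sum_distrib_left)
qed

lemma clutter_subset: "clutter n s f \<Longrightarrow> i < s \<Longrightarrow> f i \<subseteq> {..<n}"
  by (simp add: clutter_def)

lemma charvec_beyond: "clutter n s f \<Longrightarrow> i < s \<Longrightarrow> n \<le> j \<Longrightarrow> charvec f i j = 0"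
  using clutter_subset[of n s f i] by (auto simp: charvec_def)

section \<open>Equivalence with linear independence and injectivity of the multiplication
  map\<close>

text \<open>Dividing the combination by \<open>q - 1\<close> gives a vector \<open>a\<close> whose
  multiple lies in \<open>L\<close>. Injectivity writes \<open>a\<close> as a combination with
  coefficients \<open>d i\<close>, and linear independence then forces
  \<open>c i = (q - 1) * d i\<close>.\<close>

lemma indep_mod_if_lin_indep_phi_injective:
  assumes cl: "clutter n s f" and "s \<ge> 1" "q \<ge> 2"
    and li: "charvecs_lin_indep n s f" and phi: "phi_injective n s f q"
  shows "indep_mod s f (q - 1)"
  unfolding indep_mod_def
proof (intro allI impI)
  fix c :: "nat \<Rightarrow> int"
  let ?k = "int q - 1"
  let ?w = "\<lambda>i j. charvec f i j - charvec f 0 j"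
  assume "\<forall>j. int (q - 1) dvd (\<Sum>i\<in>{1..<s}. c i * ?w i j)"
  then have dv: "?k dvd (\<Sum>i\<in>{1..<s}. c i * ?w i j)" for j
    using assms(3) by (simp add: of_nat_diff)
  define a where "a j = (\<Sum>i\<in>{1..<s}. c i * ?w i j) div ?k" for j
  have ka: "?k * a j = (\<Sum>i\<in>{1..<s}. c i * ?w i j)" for j
    unfolding a_def using dv by simp
  have "a j = 0" if "j \<ge> n" for j
    unfolding a_def using that charvec_beyond[OF cl] \<open>s \<ge> 1\<close> by simp
  moreover have "(\<lambda>j. ?k * a j) \<in> lattice_L s f"
    unfolding ka lattice_L_def by blast
  ultimately have "a \<in> lattice_L s f"
    using phi by (simp add: phi_injective_def)
  then obtain d where d: "a = (\<lambda>j. \<Sum>i\<in>{1..<s}. d i * ?w i j)"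
    by (auto simp: lattice_L_def)
  \<comment> \<open>The entry at 0 makes the coefficients sum to zero, as
    \<open>sum_mult_diff_eq\<close> requires.\<close>
  define b where "b i = (if i = 0 then - (\<Sum>i\<in>{1..<s}. c i - ?k * d i) else c i - ?k * d i)" for i
  have b0: "(\<Sum>i<s. b i) = 0"
    using \<open>s \<ge> 1\<close> by (simp add: lessThan_eq_insert_0 b_def)
  have "(\<Sum>i<s. b i * charvec f i j) = 0" for j
  proof -
    have "(\<Sum>i<s. b i * charvec f i j) = (\<Sum>i\<in>{1..<s}. b i * ?w i j)"
      using sum_mult_diff_eq[OF b0 \<open>s \<ge> 1\<close>, of "\<lambda>i. charvec f i j"] by simp
    also have "\<dots> = (\<Sum>i\<in>{1..<s}. c i * ?w i j - ?k * (d i * ?w i j))"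
      by (intro sum.cong) (auto simp: b_def algebra_simps)
    also have "\<dots> = (\<Sum>i\<in>{1..<s}. c i * ?w i j) - ?k * a j"
      by (simp only: sum_subtractf sum_distrib_left d)
    finally show ?thesis
      by (simp add: ka)
  qed
  then have "(\<Sum>i<s. rat_of_int (b i) * of_int (charvec f i j)) = 0" for j
    by (metis (mono_tags, lifting) of_int_0 of_int_mult of_int_sum sum.cong)
  then have "\<forall>i<s. rat_of_int (b i) = 0"
    using li[unfolded charvecs_lin_indep_def, rule_format, of "\<lambda>i. rat_of_int (b i)"] by blast
  then have "c i = ?k * d i" if "i \<in> {1..<s}" for i
    using that by (auto simp: b_def)
  then show "\<forall>i\<in>{1..<s}. int (q - 1) dvd c i"
    using assms(3) by (simp add: of_nat_diff)
qed

text \<open>The coefficients of \<open>(q - 1) a\<close> are all divisible by \<open>q - 1\<close>,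
  so this factor cancels and leaves a representation of \<open>a\<close> in
  \<open>L\<close>.\<close>

lemma phi_injective_if_indep_mod:
  assumes "indep_mod s f (q - 1)" "q \<ge> 2"
  shows "phi_injective n s f q"
  unfolding phi_injective_def
proof (intro allI impI)
  fix a :: "nat \<Rightarrow> int"
  let ?w = "\<lambda>i j. charvec f i j - charvec f 0 j"
  assume "(\<lambda>j. (int q - 1) * a j) \<in> lattice_L s f"
  then obtain c where c: "(\<lambda>j. (int q - 1) * a j) = (\<lambda>j. \<Sum>i\<in>{1..<s}. c i * ?w i j)"
    by (auto simp: lattice_L_def)
  have k: "int (q - 1) = int q - 1"
    using assms by simp
  have "(int q - 1) dvd (\<Sum>i\<in>{1..<s}. c i * ?w i j)" for j
    using fun_cong[OF c, of j] by (metis dvd_triv_left)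
  then have "\<forall>i\<in>{1..<s}. (int q - 1) dvd c i"
    using assms(1) unfolding indep_mod_def k by blast
  then obtain d where d: "\<forall>i\<in>{1..<s}. c i = (int q - 1) * d i"
    unfolding dvd_def by metis
  have "(int q - 1) * a j = (int q - 1) * (\<Sum>i\<in>{1..<s}. d i * ?w i j)" for j
    unfolding fun_cong[OF c, of j] sum_distrib_left
    by (intro sum.cong) (use d in \<open>auto simp: mult.assoc\<close>)
  then have "a = (\<lambda>j. \<Sum>i\<in>{1..<s}. d i * ?w i j)"
    using assms(2) by auto
  then show "a \<in> lattice_L s f"
    by (auto simp: lattice_L_def)
qed

lemma common_denominator:
  fixes c :: "nat \<Rightarrow> rat"
  obtains N :: int and C :: "nat \<Rightarrow> int" where "N > 0" "\<And>i. i < s \<Longrightarrow> of_int (C i) = of_int N * c i"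
proof -
  define N where "N = (\<Prod>i<s. snd (quotient_of (c i)))"
  have "\<exists>z::int. of_int z = of_int N * c i" if "i < s" for i
  proof -
    have "c i = of_int (fst (quotient_of (c i))) / of_int (snd (quotient_of (c i)))"
      by (metis prod.collapse quotient_of_div)
    moreover have "N = snd (quotient_of (c i)) * (\<Prod>i\<in>{..<s} - {i}. snd (quotient_of (c i)))"
      unfolding N_def using that by (intro prod.remove) auto
    moreover have "snd (quotient_of (c i)) > 0"
      by (metis prod.collapse quotient_of_denom_pos)
    ultimately have "of_int N * c i =
        of_int ((\<Prod>i\<in>{..<s} - {i}. snd (quotient_of (c i))) * fst (quotient_of (c i)))"
      by (simp add: field_simps)
    then show ?thesis by metis
  qed
  then obtain C where "\<forall>i<s. of_int (C i) = of_int N * c i" by metis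
  moreover have "N > 0"
    unfolding N_def by (intro prod_pos ballI) (metis prod.collapse quotient_of_denom_pos)
  ultimately show ?thesis using that by blast
qed

text \<open>An integral relation among the differences is divisible by every power of \<open>k\<close>.\<close>

lemma indep_mod_imp_trivial_relation:
  assumes im: "indep_mod s f k" and "k \<ge> 2"
    and rel: "\<And>j. (\<Sum>i\<in>{1..<s}. c i * (charvec f i j - charvec f 0 j)) = 0"
    and i: "i \<in> {1..<s}"
  shows "c i = 0"
proof (rule ccontr)
  assume nz: "c i \<noteq> 0"
  have "\<forall>i\<in>{1..<s}. int k ^ t dvd c i"
    if "\<And>j. (\<Sum>i\<in>{1..<s}. c i * (charvec f i j - charvec f 0 j)) = 0" for t c
    using that
  proof (induction t arbitrary: c)
    case (Suc t)
    have "\<forall>i\<in>{1..<s}. int k dvd c i"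
      using im Suc.prems unfolding indep_mod_def by simp
    then obtain d where d: "\<forall>i\<in>{1..<s}. c i = int k * d i"
      unfolding dvd_def by metis
    have "int k * (\<Sum>i\<in>{1..<s}. d i * (charvec f i j - charvec f 0 j)) = 0" for j
    proof -
      have "int k * (\<Sum>i\<in>{1..<s}. d i * (charvec f i j - charvec f 0 j))
          = (\<Sum>i\<in>{1..<s}. c i * (charvec f i j - charvec f 0 j))"
        unfolding sum_distrib_left by (intro sum.cong) (use d in \<open>auto simp: mult.assoc\<close>)
      with Suc.prems show ?thesis by simp
    qed
    then have "\<forall>i\<in>{1..<s}. int k ^ t dvd d i"
      using \<open>k \<ge> 2\<close> by (intro Suc.IH) auto
    with d show ?case by (auto intro: mult_dvd_mono)
  qed auto
  \<comment> \<open>For \<open>k\<close> at least 2, \<open>k\<close> to the power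
    \<open>\<bar>c i\<bar>\<close> exceeds \<open>\<bar>c i\<bar>\<close> and cannot divide the
    nonzero \<open>c i\<close>.\<close>
  from this[OF rel, of "nat \<bar>c i\<bar>"] i have "int k ^ nat \<bar>c i\<bar> dvd c i"
    by blast
  then have "int k ^ nat \<bar>c i\<bar> \<le> \<bar>c i\<bar>"
    using nz by (metis abs_of_nat dvd_abs_iff dvd_imp_le_int of_nat_power)
  moreover have "nat \<bar>c i\<bar> < k ^ nat \<bar>c i\<bar>"
    using \<open>k \<ge> 2\<close> by (simp add: power_gt_expt)
  ultimately show False
    by (metis abs_ge_zero int_nat_eq linorder_not_less of_nat_le_iff of_nat_power)
qed

text \<open>After clearing denominators, summing a relation over all vertices gives the coefficient
  sum times the common edge size. Hence the coefficient sum is zero and the relation is one among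
  the differences, which is trivial.\<close>

lemma lin_indep_if_indep_mod:
  assumes uc: "uniform_clutter n s f" and "s \<ge> 2" "k \<ge> 2" and im: "indep_mod s f k"
  shows "charvecs_lin_indep n s f"
  unfolding charvecs_lin_indep_def
proof (intro allI impI)
  fix c :: "nat \<Rightarrow> rat" and i\<^sub>0
  assume rel: "\<forall>j<n. (\<Sum>i<s. c i * of_int (charvec f i j)) = 0" and i0: "i\<^sub>0 < s"
  have cl: "clutter n s f"
    using uc by (simp add: uniform_clutter_def)
  have card: "card (f i) = card (f 0)" if "i < s" for i
    using uc that i0 unfolding uniform_clutter_def by (metis bot_nat_0.not_eq_extremum less_nat_zero_code)
  obtain N C where N: "N > 0" and C: "\<And>i. i < s \<Longrightarrow> of_int (C i) = of_int N * c i"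
    using common_denominator[of s c] by blast
  have relC: "(\<Sum>i<s. C i * charvec f i j) = 0" for j
  proof (cases "j < n")
    case True
    have "rat_of_int (\<Sum>i<s. C i * charvec f i j) = of_int N * (\<Sum>i<s. c i * of_int (charvec f i j))"
      by (simp add: C sum_distrib_left mult.assoc)
    with rel True show ?thesis
      by (metis mult_zero_right of_int_eq_0_iff)
  next
    case False
    then show ?thesis
      using charvec_beyond[OF cl] i0 by (intro sum.neutral) auto
  qed
  have "(\<Sum>j<n. \<Sum>i<s. C i * charvec f i j) = (\<Sum>i<s. C i * int (card (f i)))"
  proof -
    have "(\<Sum>j<n. charvec f i j) = int (card (f i))" if "i < s" for i
      using clutter_subset[OF cl that]
      by (simp add: charvec_def sum.If_cases Int_absorb1)
    then show ?thesis
      by (subst sum.swap) (simp flip: sum_distrib_left)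
  qed
  also have "\<dots> = (\<Sum>i<s. C i) * int (card (f 0))"
    unfolding sum_distrib_right by (intro sum.cong refl) (metis card lessThan_iff)
  finally have "(\<Sum>i<s. C i) * int (card (f 0)) = 0"
    by (simp add: relC)
  \<comment> \<open>An empty edge would be contained in \<open>f 1\<close>.\<close>
  moreover have "card (f 0) > 0"
  proof -
    have "\<not> f 0 \<subseteq> f 1"
      using cl \<open>s \<ge> 2\<close> by (simp add: clutter_def)
    moreover have "finite (f 0)"
      using clutter_subset[OF cl, of 0] \<open>s \<ge> 2\<close> finite_subset by auto
    ultimately show ?thesis by (auto simp: card_gt_0_iff)
  qed
  ultimately have C0: "(\<Sum>i<s. C i) = 0" by simp
  have "(\<Sum>i\<in>{1..<s}. C i * (charvec f i j - charvec f 0 j)) = 0" for j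
    using sum_mult_diff_eq[OF C0, of "\<lambda>i. charvec f i j"] relC \<open>s \<ge> 2\<close> by simp
  from indep_mod_imp_trivial_relation[OF im \<open>k \<ge> 2\<close> this] have C1: "\<forall>i\<in>{1..<s}. C i = 0"
    by blast
  moreover from this C0 have "C 0 = 0"
    using \<open>s \<ge> 2\<close> by (simp add: lessThan_eq_insert_0)
  ultimately have "C i\<^sub>0 = 0"
    using i0 by (cases "i\<^sub>0 = 0") auto
  with C[OF i0] N show "c i\<^sub>0 = 0" by simp
qed

section \<open>Monomials on the parameterised set\<close>

text \<open>The exponent of \<open>x j\<close> in the monomial \<open>m\<close> after each
  \<open>t_i\<close> is replaced by the product of the \<open>x j\<close> over the edge
  \<open>f i\<close>.\<close>

definition mon_expo :: "nat \<Rightarrow> (nat \<Rightarrow> nat set) \<Rightarrow> (nat \<Rightarrow>\<^sub>0 nat) \<Rightarrow> nat \<Rightarrow> nat" where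
  "mon_expo s f m j = (\<Sum>i<s. if j \<in> f i then lookup m i else 0)"

lemma mon_eval_param:
  assumes cl: "clutter n s f" and m: "keys m \<subseteq> {..<s}"
  shows "mon_eval m (\<lambda>i. \<Prod>j\<in>f i. x j) = (\<Prod>j<n. x j ^ mon_expo s f m j)"
proof -
  have "mon_eval m (\<lambda>i. \<Prod>j\<in>f i. x j) = (\<Prod>i<s. (\<Prod>j\<in>f i. x j) ^ lookup m i)"
    by (rule mon_eval_superset) (use m in auto)
  also have "\<dots> = (\<Prod>i<s. \<Prod>j<n. x j ^ (if j \<in> f i then lookup m i else 0))"
  proof (intro prod.cong refl)
    fix i assume "i \<in> {..<s}"
    then have "f i \<subseteq> {..<n}"
      using clutter_subset[OF cl] by blast
    then show "(\<Prod>j\<in>f i. x j) ^ lookup m i = (\<Prod>j<n. x j ^ (if j \<in> f i then lookup m i else 0))"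
      unfolding prod_power_distrib
      by (intro prod.mono_neutral_cong_left) auto
  qed
  also have "\<dots> = (\<Prod>j<n. x j ^ mon_expo s f m j)"
    unfolding mon_expo_def power_sum by (rule prod.swap)
  finally show ?thesis .
qed

lemma mon_expo_le: "keys m \<subseteq> {..<s} \<Longrightarrow> mon_expo s f m j \<le> mon_deg m"
  by (auto simp: mon_expo_def mon_deg_superset[of "{..<s}"] intro!: sum_mono)

text \<open>Monomials of equal degree have exponent vectors differing by an element of
  \<open>L\<close>; this is how \<open>indep_mod\<close> applies to polynomials.\<close>

lemma mon_expo_diff:
  assumes "keys m \<subseteq> {..<s}" "keys m' \<subseteq> {..<s}" "mon_deg m = mon_deg m'" "s \<ge> 1"
  shows "int (mon_expo s f m j) - int (mon_expo s f m' j)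
    = (\<Sum>i\<in>{1..<s}. (int (lookup m i) - int (lookup m' i)) * (charvec f i j - charvec f 0 j))"
proof -
  have "(\<Sum>i<s. int (lookup m i) - int (lookup m' i)) = 0"
    using assms by (simp add: sum_subtractf mon_deg_superset[of "{..<s}"] flip: of_nat_sum)
  from sum_mult_diff_eq[OF this \<open>s \<ge> 1\<close>, of "\<lambda>i. charvec f i j"] show ?thesis
    by (simp add: mon_expo_def charvec_def of_nat_sum flip: sum_subtractf)
       (auto intro!: sum.cong)
qed

lemma units_mon_eval_cong:
  fixes x :: "nat \<Rightarrow> 'a::{finite,field}"
  assumes "clutter n s f" "keys m \<subseteq> {..<s}" "keys m' \<subseteq> {..<s}" "\<forall>j<n. x j \<noteq> 0"
    and "\<And>j. mon_expo s f m j mod (CARD('a) - 1) = mon_expo s f m' j mod (CARD('a) - 1)"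
  shows "mon_eval m (\<lambda>i. \<Prod>j\<in>f i. x j) = mon_eval m' (\<lambda>i. \<Prod>j\<in>f i. x j)"
  unfolding mon_eval_param[OF assms(1,2)] mon_eval_param[OF assms(1,3)]
proof (intro prod.cong refl)
  fix j assume "j \<in> {..<n}"
  with assms(4,5) show "x j ^ mon_expo s f m j = x j ^ mon_expo s f m' j"
    by (metis finite_field_power_mod lessThan_iff)
qed

text \<open>Points with all coordinates 1 except the \<open>j\<close>-th isolate the exponent at
  \<open>j\<close>. Indices beyond \<open>n\<close> lie on no edge and have exponent 0.\<close>

lemma mon_expo_cong_if_eval_eq:
  assumes "clutter n s f" "keys m \<subseteq> {..<s}" "keys m' \<subseteq> {..<s}" "CARD('a) \<ge> 3"
    and eq: "\<And>x :: nat \<Rightarrow> 'a::{finite,field}. \<forall>j<n. x j \<noteq> 0 \<Longrightarrow>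
       mon_eval m (\<lambda>i. \<Prod>j\<in>f i. x j) = mon_eval m' (\<lambda>i. \<Prod>j\<in>f i. x j)"
  shows "mon_expo s f m j mod (CARD('a) - 1) = mon_expo s f m' j mod (CARD('a) - 1)"
proof (cases "j < n")
  case True
  have pr: "(\<Prod>i<n. (if i = j then y else 1) ^ e i) = y ^ e j" for y :: 'a and e
    using True by (subst prod.remove[of _ j]) auto
  show ?thesis
  proof (rule units_power_eq_imp_cong)
    fix y :: 'a assume "y \<noteq> 0"
    then show "y ^ mon_expo s f m j = y ^ mon_expo s f m' j"
      using eq[of "\<lambda>i. if i = j then y else 1"]
      unfolding mon_eval_param[OF assms(1,2)] mon_eval_param[OF assms(1,3)] pr by simp
  qed fact
next
  case False
  then have "j \<notin> f i" if "i < s" for i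
    using clutter_subset[OF assms(1) that] by auto
  then show ?thesis by (simp add: mon_expo_def)
qed

lemma param_pointsI: "\<forall>j<n. x j \<noteq> 0 \<Longrightarrow> (\<lambda>i. \<Prod>j\<in>f i. x j) \<in> param_points n f"
  by (auto simp: param_points_def)

lemma vanishing_ideal_mpeval_eq_0:
  "p \<in> vanishing_ideal n s f \<Longrightarrow> P \<in> param_points n f \<Longrightarrow> mpeval p P = 0"
  unfolding vanishing_ideal_def by (rule gen_ideal_mpeval_eq_0) auto

section \<open>The binomials that define the torus\<close>

definition torus_gen :: "nat \<Rightarrow> nat \<Rightarrow> 'a::comm_ring_1 mpoly" where
  "torus_gen k i = single (single i k) 1 - single (single 0 k) 1"

lemma keys_torus_gen: "keys (torus_gen k i) \<subseteq> {single i k, single 0 k}"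
  unfolding torus_gen_def using keys_diff[of "single (single i k) 1" "single (single 0 k) 1"]
  by (auto split: if_splits)

lemma in_S_torus_gen: "i < s \<Longrightarrow> in_S s (torus_gen k i)"
  unfolding torus_gen_def by (intro in_S_diff in_S_single) auto

lemma mon_deg_torus_gen: "m \<in> keys (torus_gen k i) \<Longrightarrow> mon_deg m = k"
  using keys_torus_gen[of k i] by auto

lemma mpeval_torus_gen:
  fixes P :: "nat \<Rightarrow> 'a::{finite,field}"
  assumes "P i \<noteq> 0" "P 0 \<noteq> 0"
  shows "mpeval (torus_gen (CARD('a) - 1) i) P = 0"
  unfolding torus_gen_def mpeval_diff mpeval_single mon_eval_single
  by (simp only: finite_field_power_card_minus_1[OF assms(1)] finite_field_power_card_minus_1[OF assms(2)])
     simp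

lemma param_points_nonzero:
  assumes "clutter n s f" "P \<in> param_points n f" "i < s"
  shows "P i \<noteq> (0::'a::field)"
proof -
  from assms obtain x where x: "P = (\<lambda>i. \<Prod>j\<in>f i. x j)" "\<forall>j<n. x j \<noteq> 0"
    by (auto simp: param_points_def)
  have "f i \<subseteq> {..<n}"
    using assms clutter_subset by blast
  with x show ?thesis
    by (cases "finite (f i)") auto
qed

lemma torus_gen_vanishing:
  assumes "clutter n s f" "i < s"
  shows "torus_gen (CARD('a) - 1) i \<in> (vanishing_ideal n s f :: 'a::{finite,field} mpoly set)"
  unfolding vanishing_ideal_def
proof (intro gen_ideal_base CollectI conjI ballI)
  show "homogeneous (torus_gen (CARD('a) - 1) i :: 'a mpoly)"
    unfolding homogeneous_def using mon_deg_torus_gen by blast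
  fix P :: "nat \<Rightarrow> 'a" assume "P \<in> param_points n f"
  then show "mpeval (torus_gen (CARD('a) - 1) i) P = 0"
    by (intro mpeval_torus_gen param_points_nonzero[OF assms(1)]) (use assms in auto)
qed (use assms in_S_torus_gen in auto)

section \<open>Complete intersections are tori\<close>

text \<open>Below degree \<open>q - 1\<close>, pulling back along the parameterisation gives a polynomial of degree
  less than \<open>q - 1\<close> in each variable, so vanishing on units forces vanishing everywhere. At the
  indicator vector of the edge \<open>f k\<close> only the pure powers of \<open>t\<^sub>k\<close> survive.\<close>

lemma pure_power_coeff_eq_0:
  fixes p :: "'a::{finite,field} mpoly"
  assumes cl: "clutter n s f" and S: "in_S s p" and hom: "homogeneous p"
    and van: "\<forall>P\<in>param_points n f. mpeval p P = 0"
    and k: "k < s" and e: "e < CARD('a) - 1"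
  shows "lookup p (single k e) = 0"
proof (rule ccontr)
  assume "lookup p (single k e) \<noteq> 0"
  then have ke: "single k e \<in> keys p"
    by (simp add: in_keys_iff)
  then have deg: "mon_deg m = e" if "m \<in> keys p" for m
    using hom that by (metis homogeneous_def mon_deg_single)
  have mS: "keys m \<subseteq> {..<s}" if "m \<in> keys p" for m
    using S that by (auto simp: in_S_def)
  define F where "F x = mpeval p (\<lambda>i. \<Prod>j\<in>f i. x j)" for x
  have F: "F x = (\<Sum>m\<in>keys p. lookup p m * (\<Prod>j<n. x j ^ mon_expo s f m j))" for x
    unfolding F_def mpeval_alt by (intro sum.cong refl) (simp add: mon_eval_param[OF cl mS])
  \<comment> \<open>Induction on the set \<open>Z\<close> of coordinates allowed to be zero; with
    \<open>Z = {..<n}\<close> no restriction on \<open>x\<close> remains.\<close>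
  have "F x = 0" if "finite Z" "Z \<subseteq> {..<n}" "\<forall>j<n. j \<notin> Z \<longrightarrow> x j \<noteq> 0" for Z x
    using that
  proof (induction Z arbitrary: x rule: finite_induct)
    case empty
    then show ?case
      using van param_pointsI[of n x f] by (simp add: F_def)
  next
    case (insert z Z)
    let ?a = "\<lambda>m. lookup p m * (\<Prod>j\<in>{..<n} - {z}. x j ^ mon_expo s f m j)"
    have Fz: "F (x(z := y)) = (\<Sum>m\<in>keys p. ?a m * y ^ mon_expo s f m z)" for y
      unfolding F
    proof (intro sum.cong refl)
      fix m
      have "(\<Prod>j<n. (x(z := y)) j ^ mon_expo s f m j)
          = y ^ mon_expo s f m z * (\<Prod>j\<in>{..<n} - {z}. (x(z := y)) j ^ mon_expo s f m j)"
        using insert.prems(1) by (subst prod.remove[of _ z]) auto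
      also have "(\<Prod>j\<in>{..<n} - {z}. (x(z := y)) j ^ mon_expo s f m j)
          = (\<Prod>j\<in>{..<n} - {z}. x j ^ mon_expo s f m j)"
        by (intro prod.cong) auto
      finally show "lookup p m * (\<Prod>j<n. (x(z := y)) j ^ mon_expo s f m j) = ?a m * y ^ mon_expo s f m z"
        by (simp add: algebra_simps)
    qed
    show ?case
    proof (cases "x z = 0")
      case True
      \<comment> \<open>In the coordinate \<open>z\<close> alone every exponent is at most the
        degree \<open>e\<close>, hence below \<open>q - 1\<close>, and the induction hypothesis
        gives vanishing at every unit.\<close>
      have "(\<Sum>m\<in>keys p. ?a m * 0 ^ mon_expo s f m z) = 0"
      proof (rule power_sum_vanishes_at_0)
        show "mon_expo s f m z < CARD('a) - 1" if "m \<in> keys p" for m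
          using mon_expo_le[OF mS[OF that], of f z] deg[OF that] e by linarith
        show "(\<Sum>m\<in>keys p. ?a m * y ^ mon_expo s f m z) = 0" if "y \<noteq> 0" for y
          unfolding Fz[symmetric] by (rule insert.IH) (use insert.prems that in auto)
      qed simp
      then have "F (x(z := 0)) = 0"
        unfolding Fz .
      moreover have "x(z := 0) = x"
        using True by auto
      ultimately show ?thesis by simp
    qed (use insert in auto)
  qed
  from this[of "{..<n}"] have F0: "F x = 0" for x
    by simp
  define t where "t = (\<lambda>i. \<Prod>j\<in>f i. if j \<in> f k then 1 else 0 :: 'a)"
  \<comment> \<open>For \<open>i \<noteq> k\<close> the edge \<open>f i\<close> has a vertex outside
    \<open>f k\<close>, which contributes a factor 0.\<close>
  have t: "t i = (if i = k then 1 else 0)" if "i < s" for i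
  proof -
    have "finite (f i)"
      using clutter_subset[OF cl that] finite_subset by blast
    moreover have "\<not> f i \<subseteq> f k" if "i \<noteq> k"
      using cl k \<open>i < s\<close> that by (auto simp: clutter_def)
    ultimately show ?thesis
      by (auto simp: t_def)
  qed
  have "mon_eval m t = (if m = single k e then 1 else 0)" if m: "m \<in> keys p" for m
  proof (cases "keys m \<subseteq> {k}")
    case True
    then have "m = single k (lookup m k)"
      by (intro poly_mapping_eqI) (auto simp: lookup_single when_def in_keys_iff)
    with deg[OF m] have "m = single k e"
      by (metis mon_deg_single)
    with t[OF k] show ?thesis by simp
  next
    case False
    then obtain i where "i \<in> keys m" "i \<noteq> k" by auto
    moreover from this have "i < s"
      using mS[OF m] by blast
    ultimately have "t i ^ lookup m i = 0"
      by (simp add: t in_keys_iff)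
    with \<open>i \<in> keys m\<close> have "mon_eval m t = 0"
      by (auto simp: mon_eval_def intro: prod_zero)
    with False show ?thesis
      by (auto split: if_splits)
  qed
  then have "mpeval p t = (\<Sum>m\<in>keys p. if m = single k e then lookup p m else 0)"
    unfolding mpeval_alt by (intro sum.cong) auto
  also have "\<dots> = lookup p (single k e)"
    using ke by simp
  also have "mpeval p t = 0"
    using F0 by (simp add: F_def t_def)
  finally show False
    using \<open>lookup p (single k e) \<noteq> 0\<close> by simp
qed

text \<open>A proper divisor of a pure power is a pure power of smaller exponent; below
  \<open>q - 1\<close> such monomials do not occur in the generators.\<close>

lemma single_eq_add_imp_single:
  fixes a b :: "nat \<Rightarrow>\<^sub>0 nat"
  assumes "a + b = single k e" "a \<noteq> 0"
  obtains e' where "b = single k e'" "e' < e"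
proof -
  have ab: "lookup a i + lookup b i = (if i = k then e else 0)" for i
    using arg_cong[OF assms(1), of "\<lambda>m. lookup m i"]
    by (auto simp: lookup_add lookup_single when_def)
  have ab0: "lookup a i = 0 \<and> lookup b i = 0" if "i \<noteq> k" for i
    using ab[of i] that by simp
  have "a = single k (lookup a k)"
    by (rule poly_mapping_eqI) (use ab0 in \<open>simp add: lookup_single when_def\<close>)
  with assms(2) have "lookup a k \<noteq> 0"
    by (metis single_zero)
  moreover have "b = single k (lookup b k)"
    by (rule poly_mapping_eqI) (use ab0 in \<open>simp add: lookup_single when_def\<close>)
  ultimately show ?thesis
    using ab[of k] that[of "lookup b k"] by auto
qed

text \<open>If \<open>g\<^sub>0, \<dots>, g\<^bsub>s-2\<^esub>\<close> generate the ideal, the coefficients of the \<open>t\<^sub>i\<^bsup>q-1\<^esup>\<close>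
  in \<open>t\<^sub>i\<^bsup>q-1\<^esup> - t\<^sub>0\<^bsup>q-1\<^esup> = \<Sum>\<^sub>j r\<^sub>i\<^sub>j g\<^sub>j\<close> only see the constant terms of the
  \<open>r\<^sub>i\<^sub>j\<close>, which therefore form an invertible matrix.\<close>

lemma complete_intersection_vanishes_on_torus:
  fixes p :: "'a::{finite,field} mpoly"
  assumes cl: "clutter n s f" and "s \<ge> 2" "CARD('a) \<ge> 3"
    and ci: "complete_intersection s (vanishing_ideal n s f :: 'a mpoly set)"
    and p: "p \<in> vanishing_ideal n s f"
    and P: "\<And>i. i < s \<Longrightarrow> P i \<noteq> 0"
  shows "mpeval p P = 0"
proof -
  define k where "k = CARD('a) - 1"
  define N where "N = s - 1"
  have N: "Suc i < s" if "i < N" for i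
    using that by (simp add: N_def)
  obtain g :: "nat \<Rightarrow> 'a mpoly" where g: "\<And>i. i < N \<Longrightarrow> in_S s (g i)" "\<And>i. i < N \<Longrightarrow> homogeneous (g i)"
    and I: "vanishing_ideal n s f = gen_ideal s (g ` {..<N})"
    using ci by (auto simp: complete_intersection_def N_def)
  have gI: "g j \<in> vanishing_ideal n s f" if "j < N" for j
    unfolding I by (rule gen_ideal_base) (use that in auto)
  have "\<exists>r. torus_gen k (Suc i) = (\<Sum>j<N. r j * g j)" if "i < N" for i
  proof -
    have "torus_gen k (Suc i) \<in> gen_ideal s (g ` {..<N})"
      unfolding I[symmetric] k_def using torus_gen_vanishing[OF cl] N[OF that] by blast
    then show ?thesis
      by (rule gen_ideal_image) auto
  qed
  then obtain r where r: "\<And>i. i < N \<Longrightarrow> torus_gen k (Suc i) = (\<Sum>j<N. r i j * g j)"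
    by metis
  define R where "R i j = lookup (r i j) 0" for i j
  define G where "G j i = lookup (g j) (single (Suc i) k)" for i j
  have RG: "(\<Sum>j<N. R i j * G j l) = (if i = l then 1 else 0)" if "i < N" "l < N" for i l
  proof -
    have "lookup (r i j * g j) (single (Suc l) k) = R i j * G j l" if j: "j < N" for j
      unfolding R_def G_def
    proof (rule lookup_mult_only_const)
      fix a b :: "nat \<Rightarrow>\<^sub>0 nat" assume "a \<noteq> 0" and b: "b \<in> keys (g j)"
      show "a + b \<noteq> single (Suc l) k"
      proof
        assume "a + b = single (Suc l) k"
        then obtain e where "b = single (Suc l) e" "e < k"
          using \<open>a \<noteq> 0\<close> by (rule single_eq_add_imp_single)
        with pure_power_coeff_eq_0[OF cl g(1,2)[OF j], of "Suc l" e] b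
        show False
          using N[OF \<open>l < N\<close>] vanishing_ideal_mpeval_eq_0[OF gI[OF j]]
          by (auto simp: in_keys_iff k_def)
      qed
    qed
    then have "(\<Sum>j<N. R i j * G j l) = lookup (torus_gen k (Suc i) :: 'a mpoly) (single (Suc l) k)"
      by (simp add: r[OF \<open>i < N\<close>] lookup_sum)
    also have "\<dots> = (if i = l then 1 else 0)"
    proof -
      have "single (Suc i) k = single (Suc l) k \<longleftrightarrow> i = l" "single 0 k \<noteq> single (Suc l) k"
        using \<open>CARD('a) \<ge> 3\<close> by (auto simp: k_def dest!: arg_cong[of _ _ keys])
      then show ?thesis
        by (simp add: torus_gen_def lookup_minus lookup_single)
    qed
    finally show ?thesis .
  qed
  note GR = right_inverse_imp_left_inverse[OF RG]
  \<comment> \<open>As \<open>G\<close> times \<open>R\<close> is the identity, row \<open>j\<close>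
    of \<open>G\<close> is nonzero. So \<open>g j\<close> contains a pure power of degree
    \<open>k\<close>, and homogeneity fixes its degree.\<close>
  have deg: "mon_deg m = k" if j: "j < N" and m: "m \<in> keys (g j)" for j m
  proof -
    have "(\<Sum>i<N. G j i * R i j) \<noteq> 0"
      using GR[of j j] j by simp
    then obtain i where "G j i \<noteq> 0"
      by (metis (no_types, lifting) mult_eq_0_iff sum.neutral)
    then have "single (Suc i) k \<in> keys (g j)"
      by (simp add: G_def in_keys_iff)
    with g(2)[OF j] m show ?thesis
      by (metis homogeneous_def mon_deg_single)
  qed
  \<comment> \<open>Every \<open>g j\<close> has degree \<open>k\<close>, so nonconstant terms of
    \<open>r i j\<close> only contribute in degrees above \<open>k\<close>, where the binomial has
    no terms.\<close>
  have gen_eq: "torus_gen k (Suc i) = (\<Sum>j<N. single 0 (R i j) * g j)" if "i < N" for i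
  proof (rule poly_mapping_eqI)
    fix m
    show "lookup (torus_gen k (Suc i)) m = lookup (\<Sum>j<N. single 0 (R i j) * g j) m"
    proof (cases "mon_deg m = k")
      case True
      have "lookup (r i j * g j) m = R i j * lookup (g j) m" if "j < N" for j
        unfolding R_def
      proof (rule lookup_mult_only_const)
        fix a b :: "nat \<Rightarrow>\<^sub>0 nat" assume "a \<noteq> 0" "b \<in> keys (g j)"
        then have "mon_deg (a + b) \<noteq> k"
          using deg[OF that, of b] by simp
        with True show "a + b \<noteq> m" by blast
      qed
      then show ?thesis
        by (simp add: r[OF \<open>i < N\<close>] lookup_sum lookup_const_mult)
    next
      case False
      then have "m \<notin> keys (torus_gen k (Suc i) :: 'a mpoly)" "\<forall>j<N. m \<notin> keys (g j)"
        using mon_deg_torus_gen deg by blast+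
      then show ?thesis
        by (simp add: lookup_sum lookup_const_mult in_keys_iff)
    qed
  qed
  have Rg: "(\<Sum>j<N. R i j * mpeval (g j) P) = 0" if "i < N" for i
  proof -
    have "mpeval (torus_gen k (Suc i)) P = 0"
      unfolding k_def by (rule mpeval_torus_gen) (use P N[OF that] \<open>s \<ge> 2\<close> in auto)
    then show ?thesis
      by (simp add: gen_eq[OF that] mpeval_sum mpeval_mult)
  qed
  \<comment> \<open>Multiplying the system \<open>Rg\<close> by \<open>G\<close> from the left
    recovers the individual values.\<close>
  have g0: "mpeval (g j) P = 0" if "j < N" for j
  proof -
    have "mpeval (g j) P = (\<Sum>l<N. if j = l then mpeval (g l) P else 0)"
      using that by simp
    also have "\<dots> = (\<Sum>l<N. \<Sum>i<N. G j i * R i l * mpeval (g l) P)"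
      using that by (intro sum.cong refl) (simp add: GR flip: sum_distrib_right)
    also have "\<dots> = (\<Sum>i<N. G j i * (\<Sum>l<N. R i l * mpeval (g l) P))"
      by (subst sum.swap) (simp add: sum_distrib_left mult.assoc)
    also have "\<dots> = 0"
      by (simp add: Rg)
    finally show ?thesis .
  qed
  show ?thesis
    by (rule gen_ideal_mpeval_eq_0[OF p[unfolded I]]) (use g0 in auto)
qed

text \<open>A combination divisible by \<open>q - 1\<close> yields a binomial vanishing on
  \<open>X\<close>, hence on the whole torus, where each exponent can be tested separately.\<close>

lemma indep_mod_if_complete_intersection:
  assumes cl: "clutter n s f" and "s \<ge> 2" and q: "CARD('a) \<ge> 3"
    and ci: "complete_intersection s (vanishing_ideal n s f :: 'a::{finite,field} mpoly set)"
  shows "indep_mod s f (CARD('a) - 1)"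
  unfolding indep_mod_def
proof (intro allI impI ballI)
  fix c :: "nat \<Rightarrow> int" and i\<^sub>0
  define k where "k = CARD('a) - 1"
  let ?w = "\<lambda>i j. charvec f i j - charvec f 0 j"
  assume "\<forall>j. int (CARD('a) - 1) dvd (\<Sum>i\<in>{1..<s}. c i * ?w i j)" and i0: "i\<^sub>0 \<in> {1..<s}"
  then have dv: "int k dvd (\<Sum>i\<in>{1..<s}. c i * ?w i j)" for j
    by (simp add: k_def)
  have "k > 0"
    using q by (simp add: k_def)
  \<comment> \<open>Residues turn the integers \<open>c i\<close> into exponents; the power of
    \<open>t_0\<close> in \<open>m'\<close> below balances the degrees.\<close>
  define e where "e i = nat (c i mod int k)" for i
  have e: "int (e i) = c i mod int k" for i
    using \<open>k > 0\<close> by (simp add: e_def)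
  define m where "m = (\<Sum>i\<in>{1..<s}. single i (e i))"
  define m' :: "nat \<Rightarrow>\<^sub>0 nat" where "m' = single 0 (\<Sum>i\<in>{1..<s}. e i)"
  have lm: "lookup m i = (if i \<in> {1..<s} then e i else 0)" for i
    by (auto simp: m_def lookup_sum lookup_single when_def)
  have keys: "keys m \<subseteq> {..<s}" "keys m' \<subseteq> {..<s}"
    using \<open>s \<ge> 2\<close> by (auto simp: in_keys_iff lm m'_def split: if_splits)
  have deg: "mon_deg m = mon_deg m'"
    using \<open>s \<ge> 2\<close>
    by (simp add: mon_deg_superset[OF _ keys(1)] m'_def lm lessThan_eq_insert_0)
  define p :: "'a mpoly" where "p = single m 1 - single m' 1"
  have keysp: "keys p \<subseteq> {m, m'}"
    unfolding p_def using keys_diff[of "single m 1" "single m' 1"] by auto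
  have expo: "mon_expo s f m j mod k = mon_expo s f m' j mod k" for j
  proof -
    have "int (mon_expo s f m j) - int (mon_expo s f m' j) = (\<Sum>i\<in>{1..<s}. int (e i) * ?w i j)"
      using \<open>s \<ge> 2\<close>
      by (subst mon_expo_diff[OF keys deg]) (auto simp: lm m'_def lookup_single when_def intro!: sum.cong)
    also have "\<dots> mod int k = (\<Sum>i\<in>{1..<s}. (int (e i) * ?w i j) mod int k) mod int k"
      by (rule mod_sum_eq[symmetric])
    also have "\<dots> = (\<Sum>i\<in>{1..<s}. (c i * ?w i j) mod int k) mod int k"
      by (simp only: e mod_mult_left_eq)
    also have "\<dots> = (\<Sum>i\<in>{1..<s}. c i * ?w i j) mod int k"
      by (rule mod_sum_eq)
    also have "\<dots> = 0"
      using dv by simp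
    finally have "int (mon_expo s f m j) mod int k = int (mon_expo s f m' j) mod int k"
      by (simp add: mod_eq_dvd_iff mod_eq_0_iff_dvd)
    then show ?thesis
      by (metis of_nat_eq_iff zmod_int)
  qed
  have "p \<in> vanishing_ideal n s f"
    unfolding vanishing_ideal_def
  proof (intro gen_ideal_base CollectI conjI ballI)
    show "in_S s p"
      using keys unfolding p_def by (intro in_S_diff in_S_single)
    show "homogeneous p"
      unfolding homogeneous_def using keysp deg by (intro exI[of _ "mon_deg m"]) auto
    fix Q :: "nat \<Rightarrow> 'a" assume "Q \<in> param_points n f"
    then obtain x where "Q = (\<lambda>i. \<Prod>j\<in>f i. x j)" "\<forall>j<n. x j \<noteq> 0"
      by (auto simp: param_points_def)
    then show "mpeval p Q = 0"
      using units_mon_eval_cong[OF cl keys _ expo[unfolded k_def]]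
      by (simp add: p_def mpeval_diff)
  qed
  then have p0: "mpeval p Q = 0" if "\<And>i. i < s \<Longrightarrow> Q i \<noteq> 0" for Q
    using complete_intersection_vanishes_on_torus[OF cl \<open>s \<ge> 2\<close> q ci] that by blast
  have "y ^ e i\<^sub>0 = y ^ 0" if "y \<noteq> 0" for y :: 'a
  proof -
    \<comment> \<open>Only the coordinate \<open>i\<^sub>0\<close>, which is not 0, differs from 1.
      So \<open>m'\<close> evaluates to 1 and \<open>m\<close> to a power of
      \<open>y\<close>.\<close>
    define Q where "Q i = (if i = i\<^sub>0 then y else 1)" for i
    have "mon_eval m Q = (\<Prod>i\<in>{i\<^sub>0}. Q i ^ lookup m i)"
      unfolding mon_eval_superset[OF _ keys(1), simplified]
      by (rule prod.mono_neutral_right) (use i0 in \<open>auto simp: Q_def\<close>)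
    also have "\<dots> = y ^ e i\<^sub>0"
      using i0 by (simp add: lm Q_def)
    finally have "mon_eval m Q = y ^ e i\<^sub>0" .
    moreover have "mon_eval m' Q = 1"
      using i0 by (simp add: m'_def Q_def)
    moreover have "mpeval p Q = 0"
      by (rule p0) (use that in \<open>simp add: Q_def\<close>)
    ultimately show ?thesis
      by (simp add: p_def mpeval_diff)
  qed
  from units_power_eq_imp_cong[OF this q] have "e i\<^sub>0 mod k = 0"
    by (simp add: k_def)
  then have "int (e i\<^sub>0) mod int k = 0"
    by (metis of_nat_0 zmod_int)
  then have "int k dvd c i\<^sub>0"
    by (simp add: e mod_eq_0_iff_dvd)
  then show "int (CARD('a) - 1) dvd c i\<^sub>0"
    by (simp add: k_def)
qed

section \<open>Tori are complete intersections\<close>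

text \<open>Replacing a factor \<open>t_i^k\<close> by \<open>t_0^k\<close> keeps the degree and the
  class modulo \<open>J\<close>, while the total exponent away from \<open>t_0\<close> drops by
  \<open>k\<close>.\<close>

lemma reduce_monomial:
  fixes J :: "'a::comm_ring_1 mpoly set" and k s :: nat
  defines "J \<equiv> gen_ideal s (torus_gen k ` {1..<s})"
  assumes "k \<ge> 1" "s \<ge> 1" "keys m \<subseteq> {..<s}"
  shows "\<exists>m'. keys m' \<subseteq> {..<s} \<and> mon_deg m' = mon_deg m \<and> (\<forall>i\<in>{1..<s}. lookup m' i < k) \<and>
           single m 1 - single m' 1 \<in> J"
  using \<open>keys m \<subseteq> {..<s}\<close>
proof (induction "\<Sum>i\<in>{1..<s}. lookup m i" arbitrary: m rule: less_induct)
  case less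
  show ?case
  proof (cases "\<forall>i\<in>{1..<s}. lookup m i < k")
    case True
    with less.prems show ?thesis
      by (intro exI[of _ m]) (simp add: J_def)
  next
    case False
    then obtain i where i: "i \<in> {1..<s}" "lookup m i \<ge> k" by auto
    define a where "a = m - single i k"
    define m\<^sub>1 where "m\<^sub>1 = a + single 0 k"
    have m: "m = a + single i k"
      using i by (auto intro!: poly_mapping_eqI simp: a_def lookup_add lookup_minus lookup_single when_def)
    have ka: "keys a \<subseteq> {..<s}"
    proof
      fix j assume "j \<in> keys a"
      then have "j \<in> keys m"
        by (simp add: a_def in_keys_iff lookup_minus)
      with less.prems show "j \<in> {..<s}" by blast
    qed
    have k1: "keys m\<^sub>1 \<subseteq> {..<s}"
      using keys_add[of a "single 0 k"] ka \<open>s \<ge> 1\<close> unfolding m\<^sub>1_def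
      by (auto split: if_splits)
    have "(\<Sum>l\<in>{1..<s}. lookup m l) = (\<Sum>l\<in>{1..<s}. lookup a l) + k"
      using i(1) by (subst m) (simp add: lookup_add lookup_single when_def sum.distrib)
    moreover have "(\<Sum>l\<in>{1..<s}. lookup m\<^sub>1 l) = (\<Sum>l\<in>{1..<s}. lookup a l)"
      by (simp add: m\<^sub>1_def lookup_add lookup_single when_def)
    ultimately have "(\<Sum>l\<in>{1..<s}. lookup m\<^sub>1 l) < (\<Sum>l\<in>{1..<s}. lookup m l)"
      using \<open>k \<ge> 1\<close> by linarith
    from less.hyps[OF this k1] obtain m' where
      m': "keys m' \<subseteq> {..<s}" "mon_deg m' = mon_deg m\<^sub>1" "\<forall>i\<in>{1..<s}. lookup m' i < k"
          "single m\<^sub>1 1 - single m' 1 \<in> J"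
      by blast
    have "single a 1 * torus_gen k i \<in> J"
      unfolding J_def by (intro gen_ideal_mult gen_ideal_base in_S_single) (use i ka in auto)
    also have "single a 1 * torus_gen k i = single m 1 - (single m\<^sub>1 1 :: 'a mpoly)"
      by (simp add: torus_gen_def right_diff_distrib mult_single m m\<^sub>1_def)
    finally have "(single m 1 - single m\<^sub>1 1) + (single m\<^sub>1 1 - single m' 1) \<in> J"
      using m'(4) unfolding J_def by (rule gen_ideal_add)
    then have "single m 1 - single m' 1 \<in> J"
      by simp
    moreover have "mon_deg m\<^sub>1 = mon_deg m"
      by (simp add: m m\<^sub>1_def)
    ultimately show ?thesis
      using m' by auto
  qed
qed

text \<open>Reduced monomials of equal degree induce distinct characters of \<open>(K\<^sup>*)\<^sup>n\<close>.\<close>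

lemma reduced_vanishing_eq_0:
  fixes p :: "'a::{finite,field} mpoly"
  assumes cl: "clutter n s f" and "s \<ge> 1" and q: "CARD('a) \<ge> 3"
    and im: "indep_mod s f (CARD('a) - 1)"
    and S: "in_S s p" and hom: "homogeneous p"
    and red: "\<And>m i. m \<in> keys p \<Longrightarrow> i \<in> {1..<s} \<Longrightarrow> lookup m i < CARD('a) - 1"
    and van: "\<And>P. P \<in> param_points n f \<Longrightarrow> mpeval p P = 0"
  shows "p = 0"
proof -
  define k where "k = CARD('a) - 1"
  have mS: "keys m \<subseteq> {..<s}" if "m \<in> keys p" for m
    using S that by (auto simp: in_S_def)
  define U where "U = {x :: nat \<Rightarrow> 'a. \<forall>j<n. x j \<noteq> 0}"
  define \<chi> where "\<chi> m x = mon_eval m (\<lambda>i. \<Prod>j\<in>f i. x j)" for m and x :: "nat \<Rightarrow> 'a"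
  have \<chi>: "\<chi> m x = (\<Prod>j<n. x j ^ mon_expo s f m j)" if "m \<in> keys p" for m x
    unfolding \<chi>_def by (rule mon_eval_param[OF cl mS[OF that]])
  have "\<forall>m\<in>keys p. lookup p m = 0"
  proof (rule characters_lin_indep[where \<chi> = \<chi> and G = U and mul = "\<lambda>x y j. x j * y j"])
    show "\<exists>x\<in>U. \<chi> m x \<noteq> 0" if "m \<in> keys p" for m
      by (rule bexI[of _ "\<lambda>_. 1"]) (simp_all add: \<chi>[OF that] U_def)
    show "(\<Sum>m\<in>keys p. lookup p m * \<chi> m x) = 0" if "x \<in> U" for x
      using van[OF param_pointsI[of n x f]] that by (simp add: mpeval_alt \<chi>_def U_def)
    \<comment> \<open>Equal characters have congruent exponents on each \<open>x j\<close>, so by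
      \<open>indep_mod\<close> the exponents of each \<open>t_i\<close> with \<open>i > 0\<close>
      are congruent modulo \<open>q - 1\<close>, and being reduced they agree. The exponent of
      \<open>t_0\<close>, which has no bound, then follows from the degree.\<close>
    show "\<exists>x\<in>U. \<chi> m x \<noteq> \<chi> m' x" if m: "m \<in> keys p" "m' \<in> keys p" and "m \<noteq> m'" for m m'
    proof (rule ccontr)
      assume "\<not> (\<exists>x\<in>U. \<chi> m x \<noteq> \<chi> m' x)"
      then have eq: "mon_eval m (\<lambda>i. \<Prod>j\<in>f i. x j) = mon_eval m' (\<lambda>i. \<Prod>j\<in>f i. x j)"
        if "\<forall>j<n. x j \<noteq> 0" for x :: "nat \<Rightarrow> 'a"
        using that by (auto simp: \<chi>_def U_def)
      have deg: "mon_deg m = mon_deg m'"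
        using hom m by (metis homogeneous_def)
      have "mon_expo s f m j mod k = mon_expo s f m' j mod k" for j
        unfolding k_def using mon_expo_cong_if_eval_eq[OF cl mS[OF m(1)] mS[OF m(2)] q eq] .
      then have "int k dvd (int (mon_expo s f m j) - int (mon_expo s f m' j))" for j
        by (metis mod_eq_dvd_iff zmod_int)
      then have "int k dvd int (lookup m i) - int (lookup m' i)" if "i \<in> {1..<s}" for i
        using im[unfolded indep_mod_def, rule_format, of "\<lambda>i. int (lookup m i) - int (lookup m' i)"] that
        unfolding k_def[symmetric] mon_expo_diff[OF mS[OF m(1)] mS[OF m(2)] deg \<open>s \<ge> 1\<close>]
        by blast
      note dvd = this
      have eq1: "lookup m i = lookup m' i" if "i \<in> {1..<s}" for i
      proof -
        have "int (lookup m i) mod int k = int (lookup m' i) mod int k"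
          using dvd[OF that] by (simp add: mod_eq_dvd_iff)
        then show ?thesis
          using red[OF m(1) that] red[OF m(2) that] by (simp add: k_def)
      qed
      have "lookup m 0 + (\<Sum>i\<in>{1..<s}. lookup m i) = lookup m' 0 + (\<Sum>i\<in>{1..<s}. lookup m' i)"
        using deg \<open>s \<ge> 1\<close> mS[OF m(1)] mS[OF m(2)]
        by (simp add: mon_deg_superset[of "{..<s}"] lessThan_eq_insert_0)
      then have eq0: "lookup m 0 = lookup m' 0"
        using eq1 by simp
      have "lookup m i = lookup m' i" for i
      proof (cases "i < s")
        case True
        then show ?thesis
          using eq0 eq1 by (cases "i = 0") auto
      next
        case False
        then have "i \<notin> keys m" "i \<notin> keys m'"
          using mS[OF m(1)] mS[OF m(2)] by auto
        then show ?thesis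
          by (simp add: in_keys_iff)
      qed
      then show False
        using \<open>m \<noteq> m'\<close> poly_mapping_eqI by blast
    qed
  qed (auto simp: U_def \<chi> power_mult_distrib prod.distrib)
  then show ?thesis
    by (auto simp: in_keys_iff intro!: poly_mapping_eqI)
qed

text \<open>Reducing each monomial of a homogeneous vanishing \<open>p\<close> changes it by an
  element of \<open>J\<close>. The reduced polynomial still vanishes on \<open>X\<close>, hence is
  zero, and \<open>p\<close> lies in \<open>J\<close>.\<close>

lemma complete_intersection_if_indep_mod:
  assumes cl: "clutter n s f" and "s \<ge> 2" and q: "CARD('a) \<ge> 3"
    and im: "indep_mod s f (CARD('a) - 1)"
  shows "complete_intersection s (vanishing_ideal n s f :: 'a::{finite,field} mpoly set)"
proof -
  define k where "k = CARD('a) - 1"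
  define J :: "'a mpoly set" where "J = gen_ideal s (torus_gen k ` {1..<s})"
  have "k \<ge> 1" "s \<ge> 1"
    using assms by (simp_all add: k_def)
  have JI: "J \<subseteq> vanishing_ideal n s f"
    unfolding J_def vanishing_ideal_def
    by (rule gen_ideal_subset)
       (use torus_gen_vanishing[where 'a = 'a, OF cl, folded k_def] in \<open>auto simp: vanishing_ideal_def\<close>)
  have "p \<in> J" if S: "in_S s p" and hom: "homogeneous p" and van: "\<forall>P\<in>param_points n f. mpeval p P = 0"
    for p :: "'a mpoly"
  proof -
    have "\<exists>m'. keys m' \<subseteq> {..<s} \<and> mon_deg m' = mon_deg m \<and> (\<forall>i\<in>{1..<s}. lookup m' i < k) \<and>
           single m 1 - single m' 1 \<in> J" if "m \<in> keys p" for m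
      unfolding J_def using S that \<open>k \<ge> 1\<close> \<open>s \<ge> 1\<close> by (intro reduce_monomial) (auto simp: in_S_def)
    then obtain \<rho> where \<rho>: "\<And>m. m \<in> keys p \<Longrightarrow> keys (\<rho> m) \<subseteq> {..<s}"
        "\<And>m. m \<in> keys p \<Longrightarrow> mon_deg (\<rho> m) = mon_deg m"
        "\<And>m i. m \<in> keys p \<Longrightarrow> i \<in> {1..<s} \<Longrightarrow> lookup (\<rho> m) i < k"
        "\<And>m. m \<in> keys p \<Longrightarrow> single m 1 - single (\<rho> m) 1 \<in> J"
      by metis
    \<comment> \<open>Several monomials may share a reduced form, so terms can merge or cancel; only
      an inclusion for the keys of \<open>p'\<close> is claimed.\<close>
    define p' where "p' = (\<Sum>m\<in>keys p. single (\<rho> m) (lookup p m))"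
    have "p - p' = (\<Sum>m\<in>keys p. single m (lookup p m)) - p'"
      by (simp add: poly_mapping_sum_single)
    also have "\<dots> = (\<Sum>m\<in>keys p. single 0 (lookup p m) * (single m 1 - single (\<rho> m) 1))"
      by (simp add: p'_def right_diff_distrib mult_single sum_subtractf)
    also have "\<dots> \<in> J"
      unfolding J_def
      by (intro gen_ideal_sum gen_ideal_mult in_S_single) (use \<rho>(4) in \<open>auto simp: J_def\<close>)
    finally have pp': "p - p' \<in> J" .
    have keys': "keys p' \<subseteq> \<rho> ` keys p"
      unfolding p'_def using keys_sum[of "\<lambda>m. single (\<rho> m) (lookup p m)" "keys p"]
      by (auto split: if_splits)
    have "p' = 0"
    proof (rule reduced_vanishing_eq_0[OF cl \<open>s \<ge> 1\<close> q im])
      show "in_S s p'"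
        unfolding p'_def using \<rho>(1) by (intro in_S_sum in_S_single)
      show "homogeneous p'"
        using hom keys' \<rho>(2) unfolding homogeneous_def by (metis (no_types, lifting) imageE subsetD)
      show "lookup m i < CARD('a) - 1" if "m \<in> keys p'" "i \<in> {1..<s}" for m i
        using that keys' \<rho>(3) unfolding k_def by blast
      show "mpeval p' P = 0" if "P \<in> param_points n f" for P
      proof -
        have "mpeval (p - p') P = 0"
          using pp' JI that vanishing_ideal_mpeval_eq_0 by blast
        with van that show ?thesis by (simp add: mpeval_diff)
      qed
    qed
    with pp' show ?thesis by simp
  qed
  then have "vanishing_ideal n s f \<subseteq> J"
    unfolding vanishing_ideal_def J_def by (intro gen_ideal_subset) auto
  with JI have "vanishing_ideal n s f = J" by blast
  moreover have "torus_gen k ` {1..<s} = (\<lambda>i. torus_gen k (Suc i) :: 'a mpoly) ` {..<s - 1}"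
  proof -
    have "{1..<s} = Suc ` {..<s - 1}"
      using \<open>s \<ge> 1\<close> by (auto simp: image_Suc_lessThan)
    then show ?thesis by (simp only: image_image)
  qed
  ultimately have "vanishing_ideal n s f = gen_ideal s ((\<lambda>i. torus_gen k (Suc i) :: 'a mpoly) ` {..<s - 1})"
    by (simp only: J_def)
  moreover have "\<forall>i<s - 1. in_S s (torus_gen k (Suc i) :: 'a mpoly) \<and> homogeneous (torus_gen k (Suc i) :: 'a mpoly)"
    using in_S_torus_gen mon_deg_torus_gen unfolding homogeneous_def by (metis less_diff_conv Suc_eq_plus1)
  ultimately show ?thesis
    unfolding complete_intersection_def
    by (intro exI[of _ "\<lambda>i. torus_gen k (Suc i)"] conjI)
qed

theorem theorem3p9:
  fixes n s :: nat and f :: "nat \<Rightarrow> nat set"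
  assumes "uniform_clutter n s f" and "s \<ge> 2"
    and "CARD('a) \<ge> 3"
  shows "complete_intersection s (vanishing_ideal n s f :: ('a::{finite,field}) mpoly set) \<longleftrightarrow>
           charvecs_lin_indep n s f \<and> phi_injective n s f CARD('a)"
proof -
  have cl: "clutter n s f"
    using assms(1) by (simp add: uniform_clutter_def)
  have "complete_intersection s (vanishing_ideal n s f :: 'a mpoly set) \<longleftrightarrow> indep_mod s f (CARD('a) - 1)"
    using indep_mod_if_complete_intersection complete_intersection_if_indep_mod cl assms(2,3) by blast
  also have "\<dots> \<longleftrightarrow> charvecs_lin_indep n s f \<and> phi_injective n s f CARD('a)"
  proof
    assume im: "indep_mod s f (CARD('a) - 1)"
    have "charvecs_lin_indep n s f"
      by (rule lin_indep_if_indep_mod[OF assms(1,2) _ im]) (use assms(3) in simp)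
    moreover have "phi_injective n s f CARD('a)"
      by (rule phi_injective_if_indep_mod[OF im]) (use assms(3) in simp)
    ultimately show "charvecs_lin_indep n s f \<and> phi_injective n s f CARD('a)" ..
  next
    assume "charvecs_lin_indep n s f \<and> phi_injective n s f CARD('a)"
    then show "indep_mod s f (CARD('a) - 1)"
      using assms(2,3) by (intro indep_mod_if_lin_indep_phi_injective[OF cl]) auto
  qed
  finally show ?thesis .
qed

end
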